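(* Consider a single-phase chain feeder with nodes $0,1,\dots,N$, in which line $n$ ($1\le n\le N$) connects nodes $n-1$ and $n$ and has impedance $z_n\in\mathbb{C}$, and let the phase reference be chosen with respect to the last node, i.e. $\delta_N=0$. Let $j_n=|j_n|e^{i\beta_n}$ be the local current of line $n$, related to the global line current $j^g_n$ by $j^g_n=j_ne^{i\delta_n}$. Set $\Delta_n=\delta_{n-1}-\delta_n$. Then $$v_{n-1}e^{i\Delta_n}-v_n=j_nz_n\quad(1\le n\le N),\qquad j_{n-1}=i_{n-1}+j_ne^{-i\Delta_n}\quad(2\le n\le N).$$
   Context: The network is in steady state and all quantities are phasors; $i$ in an exponent is the imaginary unit. At node $n$: $v_n=|v_n|\ge 0$ is the local voltage; $\delta_n\in\mathbb{R}$ is the phase of the voltage phasor with respect to the global phase reference; $v^g_n=v_ne^{i\delta_n}$ is the global voltage; $i_n=|i_n|e^{i\theta_n}\in\mathbb{C}$ is the local current consumed (or injected) at node $n$, where $\theta_n$ is the angle between the voltage and current phasors; $i^g_n=i_ne^{i\delta_n}$ is the global node current. The global current in line $n$, flowing from node $n-1$ to node $n$, is $j^g_n\in\mathbb{C}$. The feeder obeys Ohm's law $v^g_{n-1}-v^g_n=j^g_nz_n$ for $1\le n\le N$, and Kirchhoff's current law $j^g_{n-1}=i^g_{n-1}+j^g_n$ for $2\le n\le N$, with $j^g_N=i^g_N$ at the end of the feeder. *)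

theory Defs
  imports Complex_Main
begin

definition to_global :: "(nat \<Rightarrow> real) \<Rightarrow> (nat \<Rightarrow> complex) \<Rightarrow> nat \<Rightarrow> complex" where
  "to_global \<delta> x n = x n * exp (\<i> * complex_of_real (\<delta> n))"

definition phase_diff :: "(nat \<Rightarrow> real) \<Rightarrow> nat \<Rightarrow> real" where
  "phase_diff \<delta> n = \<delta> (n - 1) - \<delta> n"

text \<open>
  The local voltage is real and non-negative, since at each node the local phase reference is
  the voltage phasor itself; hence the argument \<open>\<theta> n\<close> of the local current is the
  angle between voltage and current. The functions are total on the naturals, but only the values
  at nodes \<open>0, \<dots>, N\<close> (for \<open>v\<close>, \<open>\<delta>\<close>, \<open>i\<close>, \<open>\<theta>\<close>)
  and at lines \<open>1, \<dots>, N\<close> (for \<open>z\<close>, \<open>jg\<close>) are constrained. Line \<open>n\<close>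
  is directed from node \<open>n - 1\<close> to node \<open>n\<close>.
\<close>

locale chain_feeder =
  fixes N :: nat
    and z :: "nat \<Rightarrow> complex"
    and v :: "nat \<Rightarrow> real"
    and \<delta> :: "nat \<Rightarrow> real"
    and i :: "nat \<Rightarrow> complex"
    and \<theta> :: "nat \<Rightarrow> real"
    and jg :: "nat \<Rightarrow> complex"
  assumes voltage_nonneg: "n \<le> N \<Longrightarrow> 0 \<le> v n"
    and current_polar:
      "n \<le> N \<Longrightarrow> i n = complex_of_real (cmod (i n)) * exp (\<i> * complex_of_real (\<theta> n))"
    and ohm:
      "1 \<le> n \<Longrightarrow> n \<le> N \<Longrightarrow>
        to_global \<delta> (\<lambda>m. complex_of_real (v m)) (n - 1)
          - to_global \<delta> (\<lambda>m. complex_of_real (v m)) n = jg n * z n"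
    and kirchhoff:
      "2 \<le> n \<Longrightarrow> n \<le> N \<Longrightarrow> jg (n - 1) = to_global \<delta> i (n - 1) + jg n"
    and kirchhoff_end: "1 \<le> N \<Longrightarrow> jg N = to_global \<delta> i N"

end

theory Submission
  imports Defs
begin

text \<open>
  Passing from local to global phasors at node \<open>n\<close> is multiplication by the unit rotation
  \<open>exp (\<i> * \<delta> n)\<close>. Each line law of the feeder involves only two neighbouring nodes, and
  the rotations at these nodes differ by the factor \<open>exp (\<plusminus> \<i> * phase_diff \<delta> n)\<close>. Hence, once
  every quantity in a law is written in the frame of a single node (the downstream node \<open>n\<close>
  for Ohm's law, the upstream node \<open>n - 1\<close> for Kirchhoff's law at that node), both sides carry
  the same rotation. It is nonzero, so it cancels, and what remains is the local law.
\<close>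

lemma to_global_cancel: "to_global \<delta> x n = to_global \<delta> y n \<longleftrightarrow> x n = y n"
  by (simp add: to_global_def)

text \<open>
  The change of frame across line \<open>n\<close>, from \<open>\<delta> (n - 1) = phase_diff \<delta> n + \<delta> n\<close>. The right-hand
  side is again a global phasor at \<open>n\<close>, so that Ohm's law can be compared with its local form
  by \<open>to_global_cancel\<close>.
\<close>

lemma to_global_upstream:
  "to_global \<delta> x (n - 1)
    = to_global \<delta> (\<lambda>m. x (m - 1) * exp (\<i> * complex_of_real (phase_diff \<delta> m))) n"
  by (simp add: to_global_def phase_diff_def mult.assoc algebra_simps flip: exp_add)

text \<open>
  The reverse change of frame. The rotation at node \<open>n - 1\<close> is left explicit because the result
  is compared with quantities indexed by \<open>n - 1\<close>.
\<close>

lemma to_global_downstream: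
  "to_global \<delta> x n
    = x n * exp (- \<i> * complex_of_real (phase_diff \<delta> n)) * exp (\<i> * complex_of_real (\<delta> (n - 1)))"
  by (simp add: to_global_def phase_diff_def mult.assoc algebra_simps flip: exp_add)

theorem proposition1:
  fixes N :: nat
    and z i jg j :: "nat \<Rightarrow> complex"
    and v \<delta> \<theta> \<beta> :: "nat \<Rightarrow> real"
  assumes feeder: "chain_feeder N z v \<delta> i \<theta> jg"
    and reference: "\<delta> N = 0"
    and local_polar: "\<And>n. 1 \<le> n \<Longrightarrow> n \<le> N \<Longrightarrow>
      j n = complex_of_real (cmod (j n)) * exp (\<i> * complex_of_real (\<beta> n))"
    and local_global: "\<And>n. 1 \<le> n \<Longrightarrow> n \<le> N \<Longrightarrow> jg n = to_global \<delta> j n"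
  shows "(\<forall>n. 1 \<le> n \<and> n \<le> N \<longrightarrow>
        complex_of_real (v (n - 1)) * exp (\<i> * complex_of_real (phase_diff \<delta> n))
          - complex_of_real (v n) = j n * z n)
    \<and> (\<forall>n. 2 \<le> n \<and> n \<le> N \<longrightarrow>
        j (n - 1) = i (n - 1) + j n * exp (- \<i> * complex_of_real (phase_diff \<delta> n)))"
proof -
  interpret chain_feeder N z v \<delta> i \<theta> jg by (fact feeder)
  have ohm_local: "complex_of_real (v (n - 1)) * exp (\<i> * complex_of_real (phase_diff \<delta> n))
      - complex_of_real (v n) = j n * z n" if "1 \<le> n" "n \<le> N" for n
  proof -
    let ?w = "\<lambda>m. complex_of_real (v (m - 1)) * exp (\<i> * complex_of_real (phase_diff \<delta> m))
      - complex_of_real (v m)"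
    have "to_global \<delta> ?w n = to_global \<delta> (\<lambda>m. complex_of_real (v m)) (n - 1)
        - to_global \<delta> (\<lambda>m. complex_of_real (v m)) n"
      unfolding to_global_upstream by (simp add: to_global_def left_diff_distrib)
    also have "\<dots> = to_global \<delta> j n * z n"
      using ohm[OF that] local_global[OF that] by simp
    also have "\<dots> = to_global \<delta> (\<lambda>m. j m * z m) n"
      by (simp add: to_global_def)
    finally show ?thesis
      by (simp only: to_global_cancel)
  qed
  have kirchhoff_local:
    "j (n - 1) = i (n - 1) + j n * exp (- \<i> * complex_of_real (phase_diff \<delta> n))"
    if "2 \<le> n" "n \<le> N" for n
  proof -
    let ?E = "exp (\<i> * complex_of_real (\<delta> (n - 1)))"
    have "j (n - 1) * ?E = jg (n - 1)"
      \<comment> \<open>\<open>2 \<le> n\<close> makes \<open>n - 1\<close> an actual line, so its local current is constrained.\<close>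
      using local_global[of "n - 1"] that by (simp add: to_global_def)
    also have "\<dots> = i (n - 1) * ?E + to_global \<delta> j n"
      using kirchhoff[OF that] local_global[of n] that by (simp add: to_global_def)
    also have "\<dots> = (i (n - 1) + j n * exp (- \<i> * complex_of_real (phase_diff \<delta> n))) * ?E"
      by (simp only: to_global_downstream distrib_right)
    finally show ?thesis
      by (simp only: mult_cancel_right exp_not_eq_zero simp_thms)
  qed
  from ohm_local kirchhoff_local show ?thesis
    by blast
qed

end
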